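(* Let $D$ be an open set in the space $\mathbb{R}^5$ with coordinates $(a_0,a_1,a_2,a_3,a_4)$, with $a_4\neq 0$ on $D$, and let $$V=\begin{pmatrix}0&0&0&0&a_1\\ a_4&0&0&0&2a_2-5a_0\\ 0&a_4&0&0&3a_3-4a_1\\ 0&0&a_4&0&4a_4-3a_2\\ 0&0&0&a_4&5-2a_3\end{pmatrix}.$$ Let $P,R,S,T,Q$ be smooth functions of $(a_0,a_1,a_2,a_3,a_4)$ on $D$, and let $W$ be the $5\times5$ matrix-valued function on $D$ with $VW=WV$ whose last row is $(a_4P,\ a_4R,\ a_4S,\ a_4T,\ Q)$. Assume that $P,R,S,T,Q$ satisfy the system of PDEs expressing that the flows $U_t+VU_x=0$ and $U_\tau+WU_x=0$, $U=(a_0,a_1,a_2,a_3,a_4)^T$, commute, i.e. at every point of $D$ and for every $\xi\in\mathbb{R}^5$, $$\bigl(D_{W\xi}V-D_{V\xi}W+V\,D_{\xi}W-W\,D_{\xi}V\bigr)\,\xi=0 .$$ Then any smooth solution $a_k(t,x)$, $k=0,\dots,4$ (defined on an open set of the $(t,x)$-plane and taking values in $D$), of the system of equations $$P=0,\qquad R=0,\qquad S=0,\qquad T=t,\qquad Q=(5-2a_3)t-x$$ is also a solution of the quasi-linear system $U_t+VU_x=0$.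
   Context: Subscripts $t$, $x$, $\tau$ denote partial derivatives; all functions are real-valued. For a matrix-valued function $A$ of $(a_0,\dots,a_4)$ and a vector $\eta=(\eta_0,\dots,\eta_4)^T$, $D_\eta A=\sum_{i=0}^{4}\eta_i\,\frac{\partial A}{\partial a_i}$ denotes the entrywise directional derivative. Where $a_4\ne0$, a matrix commuting with $V$ is uniquely determined by its last row and every row occurs as the last row of such a matrix, so $W$ is well defined by $P,R,S,T,Q$. Together with $VW=WV$, the displayed quadratic condition on $\xi$ (with $\xi$ in the role of an arbitrary value of $U_x$) is the condition for the two flows to commute, i.e. $\partial_\tau(U_t)=\partial_t(U_\tau)$; it is a system of first-order linear PDEs for $P,R,S,T,Q$. *)

theory Defs
  imports "HOL-Analysis.Analysis"
begin

text \<open>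
  The index type \<open>5\<close> has the elements \<open>0, 1, 2, 3, 4\<close>, so \<open>a $ k\<close> is literally the coordinate
  \<open>a\<^sub>k\<close>. The library function \<open>vector\<close> is not used: it starts counting at \<open>1\<close>, so over this index
  type it would put the coordinate with index \<open>0\<close> in the last place.
\<close>

definition vec5 :: "'a \<Rightarrow> 'a \<Rightarrow> 'a \<Rightarrow> 'a \<Rightarrow> 'a \<Rightarrow> 'a ^ 5" where
  "vec5 u v w y z =
     (\<chi> i. if i = 0 then u else if i = 1 then v else if i = 2 then w else if i = 3 then y else z)"

lemma vec5_nth [simp]:
  "vec5 u v w y z $ 0 = u" "vec5 u v w y z $ 1 = v" "vec5 u v w y z $ 2 = w"
  "vec5 u v w y z $ 3 = y" "vec5 u v w y z $ 4 = z"
  by (simp_all add: vec5_def)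

definition V :: "real ^ 5 \<Rightarrow> real ^ 5 ^ 5" where
  "V a = vec5
     (vec5 0       0       0       0       (a $ 1))
     (vec5 (a $ 4) 0       0       0       (2 * a $ 2 - 5 * a $ 0))
     (vec5 0       (a $ 4) 0       0       (3 * a $ 3 - 4 * a $ 1))
     (vec5 0       0       (a $ 4) 0       (4 * a $ 4 - 3 * a $ 2))
     (vec5 0       0       0       (a $ 4) (5 - 2 * a $ 3))"

definition partial_deriv :: "'n::finite \<Rightarrow> (real ^ 'n \<Rightarrow> real) \<Rightarrow> real ^ 'n \<Rightarrow> real" where
  "partial_deriv i f a = deriv (\<lambda>s. f (a + s *\<^sub>R axis i 1)) 0"

definition dir_deriv ::
    "real ^ 'n::finite \<Rightarrow> (real ^ 'n \<Rightarrow> real ^ 'm::finite ^ 'k::finite) \<Rightarrow> real ^ 'n \<Rightarrow> real ^ 'm ^ 'k" where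
  "dir_deriv \<eta> A a = (\<chi> r c. \<Sum>i\<in>UNIV. \<eta> $ i * partial_deriv i (\<lambda>b. A b $ r $ c) a)"

text \<open>
  For an open subset \<open>S\<close> of a finite-dimensional space, \<open>Ck_on n S f\<close> says that \<open>f\<close> is
  \<open>n\<close> times continuously differentiable on \<open>S\<close>, through directional derivatives of all orders;
  \<open>smooth_on S f\<close> says that \<open>f\<close> is \<open>C\<^sup>\<infinity>\<close> on \<open>S\<close>.
\<close>

primrec Ck_on :: "nat \<Rightarrow> 'a::real_normed_vector set \<Rightarrow> ('a \<Rightarrow> 'b::real_normed_vector) \<Rightarrow> bool" where
  "Ck_on 0 S f \<longleftrightarrow> continuous_on S f"
| "Ck_on (Suc n) S f \<longleftrightarrow>
     (\<forall>x\<in>S. f differentiable (at x)) \<and> (\<forall>v. Ck_on n S (\<lambda>x. frechet_derivative f (at x) v))"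

definition smooth_on :: "'a::real_normed_vector set \<Rightarrow> ('a \<Rightarrow> 'b::real_normed_vector) \<Rightarrow> bool" where
  "smooth_on S f \<longleftrightarrow> (\<forall>n. Ck_on n S f)"

end

theory Submission
  imports Defs
begin

text \<open>
  Write \<open>I\<close> for the identity matrix and \<open>D\<^sub>\<xi>\<close> for the derivative in direction \<open>\<xi>\<close>.
  \<open>V\<close> has the shape of a companion matrix, with \<open>a\<^sub>4 \<noteq> 0\<close> in place of the ones below the
  diagonal, so a matrix that commutes with \<open>V\<close> is determined by its last row
  (\<open>commuting_V_eq_0\<close>), and the first basis vector \<open>e\<^sub>0\<close> is cyclic for \<open>V\<close> (\<open>cyclic_vector_V\<close>).
  The five equations for the solution say that the last row of \<open>W\<close> is that of \<open>t V - x I\<close>. As both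
  matrices commute with \<open>V\<close>, the equations amount to the hodograph equation
  \<open>W(U(t,x)) = t V(U(t,x)) - x I\<close>.

  Fix a point \<open>(t,x)\<close> and put \<open>B(\<xi>) = D\<^sub>\<xi> W - t D\<^sub>\<xi> V\<close>. Differentiating the hodograph equation gives
  \<open>B(U\<^sub>x) = - I\<close> and \<open>B(U\<^sub>t) = V\<close>. Differentiating \<open>V W = W V\<close> and then inserting \<open>W = t V - x I\<close>
  shows that every \<open>B(\<xi>)\<close> commutes with \<open>V\<close>. The same substitution reduces the condition that
  the flows commute to \<open>(V B(\<xi>) - B(V \<xi>)) \<xi> = 0\<close>.

  What remains is linear algebra (\<open>flow_from_commuting_derivatives\<close>). The existence of a cyclic vector
  upgrades the quadratic condition to \<open>B(V \<xi>) = V B(\<xi>)\<close> for all \<open>\<xi>\<close>. Therefore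
  \<open>B(U\<^sub>t + V U\<^sub>x) = V - V = 0\<close>. Moreover \<open>B\<close> is injective, because \<open>\<xi> \<mapsto> B(\<xi>) e\<^sub>0\<close> commutes with \<open>V\<close>
  and has \<open>e\<^sub>0 = - B(U\<^sub>x) e\<^sub>0\<close> in its range, hence is onto. A cyclic
  vector exists whatever the eigenvalues of \<open>V\<close> are, so the argument covers points where they
  are complex or coincide and Riemann invariants are not available.
\<close>

section \<open>Bilinearity of matrix products\<close>

lemma bounded_bilinear_matrix_matrix_mult:
  "bounded_bilinear ((**) :: real ^ 'n::finite ^ 'm::finite \<Rightarrow> real ^ 'k::finite ^ 'n \<Rightarrow> _)"
  unfolding bilinear_conv_bounded_bilinear[symmetric] bilinear_def
  by (auto intro!: linearI simp: matrix_add_ldistrib matrix_matrix_mult_def vec_eq_iff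
      algebra_simps sum.distrib sum_distrib_left)

lemma bounded_bilinear_vector_matrix_mult:
  "bounded_bilinear ((v*) :: real ^ 'm::finite \<Rightarrow> real ^ 'n::finite ^ 'm \<Rightarrow> _)"
  unfolding bilinear_conv_bounded_bilinear[symmetric] bilinear_def
  by (auto intro!: linearI simp: vector_matrix_mult_def vec_eq_iff
      algebra_simps sum.distrib sum_distrib_left)

lemmas matrix_diff_left = bounded_bilinear.diff_left[OF bounded_bilinear_matrix_matrix_mult]
  and matrix_diff_right = bounded_bilinear.diff_right[OF bounded_bilinear_matrix_matrix_mult]
  and matrix_minus_right = bounded_bilinear.minus_right[OF bounded_bilinear_matrix_matrix_mult]
  and matrix_scaleR_left = bounded_bilinear.scaleR_left[OF bounded_bilinear_matrix_matrix_mult]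
  and matrix_scaleR_right = bounded_bilinear.scaleR_right[OF bounded_bilinear_matrix_matrix_mult]

section \<open>Cyclic vectors and matrices commuting with a cyclic matrix\<close>

text \<open>
  This says that the Krylov space spanned by \<open>e, A e, A\<^sup>2 e, \<dots>\<close> is the whole space. It is phrased
  through invariant subspaces because both of its uses, on a kernel and on a range, supply
  exactly such a subspace.
\<close>

definition cyclic_vector :: "real ^ 'n::finite ^ 'n \<Rightarrow> real ^ 'n \<Rightarrow> bool" where
  "cyclic_vector A e \<longleftrightarrow>
     (\<forall>K. subspace K \<longrightarrow> e \<in> K \<longrightarrow> (\<forall>v\<in>K. A *v v \<in> K) \<longrightarrow> K = UNIV)"

text \<open>The kernel of a matrix that commutes with \<open>A\<close> is invariant under \<open>A\<close>.\<close>

lemma commuting_eq_0_if_kills_cyclic_vector: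
  fixes A M :: "real ^ 'n::finite ^ 'n"
  assumes "cyclic_vector A e" and comm: "A ** M = M ** A" and "M *v e = 0"
  shows "M = 0"
proof -
  have "subspace {v. M *v v = 0}"
    by (simp add: linear_subspace_kernel)
  moreover have "A *v v \<in> {v. M *v v = 0}" if "v \<in> {v. M *v v = 0}" for v
  proof -
    have "M *v (A *v v) = A *v (M *v v)"
      by (simp only: matrix_vector_mul_assoc comm)
    with that show ?thesis by simp
  qed
  ultimately have "{v. M *v v = 0} = UNIV"
    using assms(1,3) unfolding cyclic_vector_def by blast
  then show ?thesis
    by (auto simp: matrix_eq)
qed

text \<open>
  If \<open>A\<close> has a basis of eigenvectors \<open>e\<^sub>i\<close> with distinct eigenvalues, the quadratic condition forces
  \<open>B(e\<^sub>i)\<close> to be a multiple of the projection to \<open>e\<^sub>i\<close>, and the conclusion follows one eigenvector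
  at a time. A cyclic vector replaces the eigenvectors and leaves no case distinction on the
  Jordan form of \<open>A\<close>: the defect \<open>C(\<xi>) = A B(\<xi>) - B(A \<xi>)\<close> commutes with \<open>A\<close> and satisfies
  \<open>C(\<xi>) \<xi> = 0\<close>, so it vanishes first at \<open>e\<close> and then, by polarization against \<open>e\<close>, everywhere.
\<close>

lemma flow_from_commuting_derivatives:
  fixes A :: "real ^ 'n::finite ^ 'n" and B :: "real ^ 'n \<Rightarrow> real ^ 'n ^ 'n"
  assumes cyc: "cyclic_vector A e"
    and lin: "linear B"
    and comm: "\<And>\<xi>. A ** B \<xi> = B \<xi> ** A"
    and quad: "\<And>\<xi>. (A ** B \<xi> - B (A *v \<xi>)) *v \<xi> = 0"
    and p: "B p = - mat 1" and q: "B q = A"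
  shows "q + A *v p = 0"
proof -
  define C where "C \<xi> = A ** B \<xi> - B (A *v \<xi>)" for \<xi>
  have C_add: "C (\<xi> + \<zeta>) = C \<xi> + C \<zeta>" for \<xi> \<zeta>
    by (simp add: C_def linear_add[OF lin] matrix_vector_right_distrib matrix_add_ldistrib)
  have C_comm: "A ** C \<xi> = C \<xi> ** A" for \<xi>
    using comm[of "A *v \<xi>"] comm[of \<xi>]
    by (simp add: C_def matrix_diff_left matrix_diff_right matrix_mul_assoc[symmetric])
       (simp add: matrix_mul_assoc)
  have C_self: "C \<xi> *v \<xi> = 0" for \<xi>
    by (simp add: C_def quad)
  have C_polar: "C \<xi> *v \<zeta> + C \<zeta> *v \<xi> = 0" for \<xi> \<zeta>
    using C_self[of "\<xi> + \<zeta>"] C_self[of \<xi>] C_self[of \<zeta>]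
    by (simp add: C_add matrix_vector_right_distrib matrix_vector_mult_add_rdistrib add.commute)
  have "C e = 0"
    by (rule commuting_eq_0_if_kills_cyclic_vector[OF cyc C_comm C_self])
  then have "C \<xi> = 0" for \<xi>
    using C_polar[of \<xi> e] by (intro commuting_eq_0_if_kills_cyclic_vector[OF cyc C_comm]) simp
  then have B_mult: "B (A *v \<xi>) = A ** B \<xi>" for \<xi>
    by (simp add: C_def)
  \<comment> \<open>Evaluation at \<open>e\<close> turns \<open>B\<close> into an endomorphism commuting with \<open>A\<close>, whose injectivity
    can be read off its range.\<close>
  define L where "L \<xi> = B \<xi> *v e" for \<xi>
  have linL: "linear L"
    by (rule linearI)
       (simp_all add: L_def linear_add[OF lin] linear_scale[OF lin] matrix_vector_mult_add_rdistrib
         scaleR_matrix_vector_assoc)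
  have "range L = UNIV"
  proof -
    have "subspace (range L)"
      using linL by (simp add: linear_subspace_image)
    moreover have "L (- p) = e"
      by (simp add: L_def linear_neg[OF lin] p)
    then have "e \<in> range L" by (metis rangeI)
    moreover have "A *v L \<xi> = L (A *v \<xi>)" for \<xi>
      by (simp add: L_def B_mult matrix_vector_mul_assoc)
    then have "\<forall>v\<in>range L. A *v v \<in> range L" by auto
    ultimately show ?thesis
      using cyc unfolding cyclic_vector_def by blast
  qed
  then have "inj L"
    using linear_surjective_imp_injective[OF linL] by simp
  moreover have "B (q + A *v p) = 0"
    by (simp add: linear_add[OF lin] B_mult p q matrix_minus_right)
  then have "L (q + A *v p) = L 0"
    by (simp add: L_def linear_0[OF lin])
  ultimately show ?thesis
    by (simp add: inj_def)
qed

section \<open>Calculus of matrix-valued functions\<close>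

lemma differentiable_vecI:
  fixes f :: "'a::real_normed_vector \<Rightarrow> 'b::euclidean_space ^ 'n::finite"
  assumes "\<And>i. (\<lambda>x. f x $ i) differentiable (at a)"
  shows "f differentiable (at a)"
proof -
  have "(\<lambda>x. f x $ i \<bullet> u) differentiable (at a)" for i u
    using assms[of i] unfolding differentiable_def
    by (auto dest: bounded_linear.has_derivative[OF bounded_linear_inner_left])
  then show ?thesis
    using differentiable_componentwise_within[of f a UNIV] by (auto simp: Basis_vec_def inner_axis)
qed

lemma differentiable_cong_open:
  assumes "f differentiable (at a)" "open S" "a \<in> S" "\<And>b. b \<in> S \<Longrightarrow> f b = g b"
  shows "g differentiable (at a)"
  using assms by (auto simp: differentiable_def intro: has_derivative_transform_within_open)

text \<open>
  The coordinate formula for the directional derivative agrees with the Frechet derivative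
  wherever the latter exists, which makes the product and chain rules available for it.
\<close>

lemma dir_deriv_eq_frechet:
  fixes A :: "real ^ 'n::finite \<Rightarrow> real ^ 'm::finite ^ 'k::finite"
  assumes A: "(A has_derivative A') (at a)"
  shows "dir_deriv \<eta> A a = A' \<eta>"
proof -
  have entry: "((\<lambda>b. A b $ r $ c) has_derivative (\<lambda>h. A' h $ r $ c)) (at a)" for r c
    by (intro bounded_linear.has_derivative[OF bounded_linear_vec_nth] A)
  have "partial_deriv i (\<lambda>b. A b $ r $ c) a = A' (axis i 1) $ r $ c" for i r c
  proof -
    have "((\<lambda>s. a + s *\<^sub>R axis i 1) has_derivative (\<lambda>s. s *\<^sub>R axis i 1)) (at (0::real))"
      by (auto intro!: derivative_eq_intros)
    from has_derivative_compose[OF this, of "\<lambda>b. A b $ r $ c" "\<lambda>h. A' h $ r $ c"] entry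
    have "((\<lambda>s. A (a + s *\<^sub>R axis i 1) $ r $ c) has_derivative (\<lambda>s. A' (s *\<^sub>R axis i 1) $ r $ c)) (at 0)"
      by simp
    moreover have "(\<lambda>s. A' (s *\<^sub>R axis i 1) $ r $ c) = (*) (A' (axis i 1) $ r $ c)"
      using linear_scale[OF has_derivative_linear[OF A]] by (auto simp: fun_eq_iff)
    ultimately show ?thesis
      unfolding partial_deriv_def by (intro DERIV_imp_deriv) (simp add: has_field_derivative_def)
  qed
  moreover have "A' \<eta> $ r $ c = (\<Sum>i\<in>UNIV. \<eta> $ i * A' (axis i 1) $ r $ c)" for r c
  proof -
    have "linear (\<lambda>h. A' h $ r $ c)"
      by (rule has_derivative_linear[OF entry])
    from linear_sum[OF this, of "\<lambda>i. \<eta> $ i *s axis i 1" UNIV] show ?thesis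
      unfolding basis_expansion
      by (simp add: scalar_mult_eq_scaleR linear_scale[OF has_derivative_linear[OF A]])
  qed
  ultimately show ?thesis
    by (simp add: dir_deriv_def vec_eq_iff)
qed

lemma smooth_on_differentiable: "smooth_on S f \<Longrightarrow> a \<in> S \<Longrightarrow> f differentiable (at a)"
  using Ck_on.simps(2)[of 0 S f] unfolding smooth_on_def by blast

section \<open>The matrix of the flow\<close>

lemma exhaust_5: "(i::5) = 0 \<or> i = 1 \<or> i = 2 \<or> i = 3 \<or> i = 4"
proof (induct i)
  case (of_int z)
  then have "z = 0 \<or> z = 1 \<or> z = 2 \<or> z = 3 \<or> z = 4" by fastforce
  then show ?case by auto
qed

lemma UNIV_5: "UNIV = {0, 1, 2, 3, 4::5}"
  using exhaust_5 by auto

lemma sum_5: "sum f (UNIV :: 5 set) = f 0 + f 1 + f 2 + f 3 + f 4"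
  unfolding UNIV_5 by (simp add: algebra_simps)

lemma forall_5: "(\<forall>i::5. Pr i) \<longleftrightarrow> Pr 0 \<and> Pr 1 \<and> Pr 2 \<and> Pr 3 \<and> Pr 4"
  by (metis exhaust_5)

lemma V_differentiable: "V differentiable (at a)"
proof -
  have "(\<lambda>a. V a $ i $ j) differentiable (at a)" for i j
    using exhaust_5[of i] exhaust_5[of j]
    by (auto simp: V_def intro!: differentiable_diff differentiable_mult differentiable_const
        bounded_linear_imp_differentiable[OF bounded_linear_vec_nth])
  then show ?thesis
    by (intro differentiable_vecI)
qed

text \<open>For \<open>i < 4\<close>, column \<open>i\<close> of \<open>V a\<close> gives \<open>V a e\<^sub>i = a\<^sub>4 e\<^sub>i\<^sub>+\<^sub>1\<close>.\<close>

lemma cyclic_vector_V: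
  assumes "a $ 4 \<noteq> 0"
  shows "cyclic_vector (V a) (axis 0 1)"
  unfolding cyclic_vector_def
proof (intro allI impI)
  fix K assume K: "subspace K" "axis 0 1 \<in> K" and inv: "\<forall>v\<in>K. V a *v v \<in> K"
  have shift: "axis j 1 \<in> K" if "axis i 1 \<in> K" "V a *v axis i 1 = (a $ 4) *\<^sub>R axis j 1" for i j
  proof -
    have "inverse (a $ 4) *\<^sub>R (V a *v axis i 1) \<in> K"
      using K(1) inv that(1) by (simp add: subspace_scale)
    with that(2) assms show ?thesis by simp
  qed
  note column = vec_eq_iff forall_5 matrix_vector_mult_def sum_5 V_def axis_def
  have "axis 1 1 \<in> K" by (rule shift[OF K(2)]) (simp add: column)
  moreover from this have "axis 2 1 \<in> K" by (rule shift) (simp add: column)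
  moreover from this have "axis 3 1 \<in> K" by (rule shift) (simp add: column)
  moreover from this have "axis 4 1 \<in> K" by (rule shift) (simp add: column)
  ultimately have ax: "axis i 1 \<in> K" for i
    using K(2) exhaust_5[of i] by auto
  have "v \<in> K" for v
  proof -
    have "(\<Sum>i\<in>UNIV. v $ i *s axis i 1) \<in> K"
      using K(1) ax by (intro subspace_sum) (auto simp: scalar_mult_eq_scaleR subspace_scale)
    then show ?thesis by (simp only: basis_expansion)
  qed
  then show "K = UNIV" by auto
qed

lemma matrix_mult_row: "(A ** B) $ i = (A $ i) v* B"
  for A :: "real ^ 'n::finite ^ 'm::finite"
  by (simp add: vec_eq_iff matrix_matrix_mult_def vector_matrix_mult_def mult.commute)

text \<open>
  For \<open>j \<ge> 1\<close> the only possibly nonzero entries in row \<open>j\<close> of \<open>V a\<close> are \<open>a\<^sub>4\<close> at position \<open>j - 1\<close> and the entry in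
  the last column. Reading off row \<open>j\<close> of \<open>V a M = M V a\<close> thus
  expresses row \<open>j - 1\<close> of \<open>M\<close> through row \<open>j\<close> and the last row. This recursion yields uniqueness
  of \<open>M\<close>, and it also transfers differentiability from the last row to the whole matrix.
\<close>

lemma commuting_V_rows:
  assumes "a $ 4 \<noteq> 0" and comm: "V a ** M = M ** V a"
    and ij: "(i, j) \<in> {(3, 4), (2, 3), (1, 2), (0, 1)}"
  shows "M $ i = inverse (a $ 4) *\<^sub>R ((M $ j) v* V a - (V a $ j $ 4) *\<^sub>R M $ 4)"
proof -
  have "(M $ j) v* V a = (V a $ j) v* M"
    using comm by (metis matrix_mult_row)
  also have "\<dots> = (a $ 4) *\<^sub>R M $ i + (V a $ j $ 4) *\<^sub>R M $ 4"
    using ij by (auto simp: vec_eq_iff vector_matrix_mult_def sum_5 V_def)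
  finally show ?thesis
    using assms(1) by simp
qed

lemma commuting_V_eq_0:
  assumes a: "a $ 4 \<noteq> 0" and comm: "V a ** M = M ** V a" and last: "M $ 4 = 0"
  shows "M = 0"
proof -
  note rows = commuting_V_rows[OF a comm]
  have "M $ 3 = 0" using rows[of 3 4] last by simp
  moreover from this have "M $ 2 = 0" using rows[of 2 3] last by simp
  moreover from this have "M $ 1 = 0" using rows[of 1 2] last by simp
  moreover from this have "M $ 0 = 0" using rows[of 0 1] last by simp
  ultimately have "M $ i = 0" for i
    using last exhaust_5[of i] by auto
  then show ?thesis
    by (simp add: vec_eq_iff)
qed

lemma commuting_V_differentiable:
  assumes "open D" "a \<in> D" and nz: "\<And>b. b \<in> D \<Longrightarrow> b $ 4 \<noteq> 0"
    and comm: "\<And>b. b \<in> D \<Longrightarrow> V b ** W b = W b ** V b"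
    and last: "(\<lambda>b. W b $ 4) differentiable (at a)"
  shows "W differentiable (at a)"
proof -
  have nth: "(\<lambda>b. f b $ i) differentiable (at a)" if "f differentiable (at a)"
    for f :: "real ^ 5 \<Rightarrow> 'b::real_normed_vector ^ 5" and i
    using that by (auto simp: differentiable_def intro: bounded_linear.has_derivative[OF bounded_linear_vec_nth])
  have step: "(\<lambda>b. W b $ i) differentiable (at a)"
    if W: "(\<lambda>b. W b $ j) differentiable (at a)" and ij: "(i, j) \<in> {(3, 4), (2, 3), (1, 2), (0, 1)}" for i j
  proof -
    have "(\<lambda>b. (W b $ j) v* V b) differentiable (at a)"
      using W V_differentiable[of a] bounded_bilinear.FDERIV[OF bounded_bilinear_vector_matrix_mult]
      unfolding differentiable_def by blast
    then have "(\<lambda>b. inverse (b $ 4) *\<^sub>R ((W b $ j) v* V b - (V b $ j $ 4) *\<^sub>R W b $ 4)) differentiable (at a)"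
      by (intro differentiable_scaleR differentiable_diff differentiable_inverse last
          nth[OF nth[OF V_differentiable]] nth[OF differentiable_ident] nz assms(2))
    then show ?thesis
      by (rule differentiable_cong_open[OF _ assms(1,2)]) (simp add: commuting_V_rows[OF nz comm ij])
  qed
  have 3: "(\<lambda>b. W b $ 3) differentiable (at a)" by (rule step[OF last]) simp
  have 2: "(\<lambda>b. W b $ 2) differentiable (at a)" by (rule step[OF 3]) simp
  have 1: "(\<lambda>b. W b $ 1) differentiable (at a)" by (rule step[OF 2]) simp
  have 0: "(\<lambda>b. W b $ 0) differentiable (at a)" by (rule step[OF 1]) simp
  have "(\<lambda>b. W b $ i) differentiable (at a)" for i
    using 0 1 2 3 last exhaust_5[of i] by auto
  then show ?thesis
    by (rule differentiable_vecI)
qed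

section \<open>The hodograph equation\<close>

theorem theorem10:
  fixes D :: "(real ^ 5) set"
    and P R S T Q :: "real ^ 5 \<Rightarrow> real"
    and W :: "real ^ 5 \<Rightarrow> real ^ 5 ^ 5"
    and G :: "(real \<times> real) set"
    and U :: "real \<times> real \<Rightarrow> real ^ 5"
  assumes "open D"
    and "\<forall>a\<in>D. a $ 4 \<noteq> 0"
    and "smooth_on D P" "smooth_on D R" "smooth_on D S" "smooth_on D T" "smooth_on D Q"
    and "\<forall>a\<in>D. V a ** W a = W a ** V a"
    and "\<forall>a\<in>D. row 4 (W a) = vec5 (a $ 4 * P a) (a $ 4 * R a) (a $ 4 * S a) (a $ 4 * T a) (Q a)"
    and "\<forall>a\<in>D. \<forall>\<xi> :: real ^ 5.
           (dir_deriv (W a *v \<xi>) V a - dir_deriv (V a *v \<xi>) W a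
             + V a ** dir_deriv \<xi> W a - W a ** dir_deriv \<xi> V a) *v \<xi> = 0"
    and "open G"
    and "smooth_on G U"
    and "U ` G \<subseteq> D"
    and "\<forall>(t, x)\<in>G. P (U (t, x)) = 0 \<and> R (U (t, x)) = 0 \<and> S (U (t, x)) = 0 \<and>
           T (U (t, x)) = t \<and> Q (U (t, x)) = (5 - 2 * U (t, x) $ 3) * t - x"
  shows "\<forall>(t, x)\<in>G. vector_derivative (\<lambda>s. U (s, x)) (at t)
           + V (U (t, x)) *v vector_derivative (\<lambda>y. U (t, y)) (at x) = 0"
proof clarify
  fix t x
  assume tx: "(t, x) \<in> G"
  note D_open = assms(1) and nz = assms(2)[rule_format] and comm = assms(8)[rule_format]
    and lastrow = assms(9)[rule_format] and flows = assms(10)[rule_format]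
    and U_in_D = assms(13) and sol = assms(14)
  define a where "a = U (t, x)"
  have a: "a \<in> D" using U_in_D tx by (auto simp: a_def)

  \<comment> \<open>Both sides commute with \<open>V\<close>, and the five equations are the equality of their last rows.\<close>
  have hodograph: "W (U z) = fst z *\<^sub>R V (U z) - snd z *\<^sub>R mat 1" if z: "z \<in> G" for z
  proof -
    have b: "U z \<in> D" using U_in_D z by auto
    have "W (U z) - (fst z *\<^sub>R V (U z) - snd z *\<^sub>R mat 1) = 0"
    proof (rule commuting_V_eq_0[OF nz[OF b]])
      show "V (U z) ** (W (U z) - (fst z *\<^sub>R V (U z) - snd z *\<^sub>R mat 1)) =
          (W (U z) - (fst z *\<^sub>R V (U z) - snd z *\<^sub>R mat 1)) ** V (U z)"
        by (simp add: matrix_diff_left matrix_diff_right matrix_scaleR_left matrix_scaleR_right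
            comm[OF b])
      show "(W (U z) - (fst z *\<^sub>R V (U z) - snd z *\<^sub>R mat 1)) $ 4 = 0"
        using lastrow[OF b] sol z
        by (auto simp: vec_eq_iff forall_5 row_def V_def mat_def case_prod_beta)
    qed
    then show ?thesis by simp
  qed

  obtain V' where V': "(V has_derivative V') (at a)"
    using V_differentiable by (auto simp: differentiable_def)
  have "(\<lambda>b. W b $ 4) differentiable (at a)"
  proof -
    have nth4: "(\<lambda>b::real^5. b $ 4) differentiable (at a)"
      by (simp add: bounded_linear_imp_differentiable bounded_linear_vec_nth)
    have "(\<lambda>b. vec5 (b $ 4 * P b) (b $ 4 * R b) (b $ 4 * S b) (b $ 4 * T b) (Q b) $ i)
        differentiable (at a)" for i
      using exhaust_5[of i] assms(3-7)[THEN smooth_on_differentiable, OF a] nth4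
      by (auto intro!: differentiable_mult)
    then have "(\<lambda>b. vec5 (b $ 4 * P b) (b $ 4 * R b) (b $ 4 * S b) (b $ 4 * T b) (Q b))
        differentiable (at a)"
      by (rule differentiable_vecI)
    moreover have "vec5 (b $ 4 * P b) (b $ 4 * R b) (b $ 4 * S b) (b $ 4 * T b) (Q b) = W b $ 4"
      if "b \<in> D" for b
      using lastrow[OF that] by (simp add: row_def)
    ultimately show ?thesis
      by (rule differentiable_cong_open[OF _ D_open a])
  qed
  then obtain W' where W': "(W has_derivative W') (at a)"
    using commuting_V_differentiable[OF D_open a nz comm] by (auto simp: differentiable_def)
  obtain U' where U': "(U has_derivative U') (at (t, x))"
    using smooth_on_differentiable[OF assms(12) tx] by (auto simp: differentiable_def)
  define q p where "q = U' (1, 0)" and "p = U' (0, 1)"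
  have "((\<lambda>s. U (s, x)) has_derivative (\<lambda>h. U' (h, 0))) (at t)"
    by (rule has_derivative_compose[where f = "\<lambda>s. (s, x)" and g = U, OF _ U'])
       (auto intro!: derivative_eq_intros)
  moreover have "U' (h, 0) = h *\<^sub>R q" for h
    using linear_scale[OF has_derivative_linear[OF U'], of h "(1, 0)"] by (simp add: q_def)
  ultimately have q: "vector_derivative (\<lambda>s. U (s, x)) (at t) = q"
    by (intro vector_derivative_at) (simp add: has_vector_derivative_def)
  have "((\<lambda>y. U (t, y)) has_derivative (\<lambda>h. U' (0, h))) (at x)"
    by (rule has_derivative_compose[where f = "\<lambda>y. (t, y)" and g = U, OF _ U'])
       (auto intro!: derivative_eq_intros)
  moreover have "U' (0, h) = h *\<^sub>R p" for h
    using linear_scale[OF has_derivative_linear[OF U'], of h "(0, 1)"] by (simp add: p_def)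
  ultimately have p: "vector_derivative (\<lambda>y. U (t, y)) (at x) = p"
    by (intro vector_derivative_at) (simp add: has_vector_derivative_def)

  have Wa: "W a = t *\<^sub>R V a - x *\<^sub>R mat 1"
    using hodograph[OF tx] by (simp add: a_def)
  define B where "B \<xi> = W' \<xi> - t *\<^sub>R V' \<xi>" for \<xi>
  have linV: "linear V'" and linW: "linear W'"
    using V' W' has_derivative_linear by auto
  then have linB: "linear B"
    unfolding B_def by (intro linear_compose_sub linear_compose_scale_right)

  \<comment> \<open>The hodograph equation differentiated in direction \<open>h\<close> of the \<open>(t,x)\<close>-plane.\<close>
  have B_U': "B (U' h) = fst h *\<^sub>R V a - snd h *\<^sub>R mat 1" for h
  proof -
    have VU: "((\<lambda>z. V (U z)) has_derivative (\<lambda>h. V' (U' h))) (at (t, x))"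
      using V' by (intro has_derivative_compose[OF U']) (simp add: a_def)
    have "((\<lambda>z. W (U z)) has_derivative (\<lambda>h. W' (U' h))) (at (t, x))"
      using W' by (intro has_derivative_compose[OF U']) (simp add: a_def)
    moreover have "((\<lambda>z. fst z *\<^sub>R V (U z) - snd z *\<^sub>R mat 1) has_derivative
        (\<lambda>h. t *\<^sub>R V' (U' h) + fst h *\<^sub>R V a - snd h *\<^sub>R mat 1)) (at (t, x))"
      by (auto intro!: derivative_eq_intros VU simp: a_def)
    then have "((\<lambda>z. W (U z)) has_derivative
        (\<lambda>h. t *\<^sub>R V' (U' h) + fst h *\<^sub>R V a - snd h *\<^sub>R mat 1)) (at (t, x))"
      by (rule has_derivative_transform_within_open[OF _ assms(11) tx]) (simp add: hodograph)
    ultimately have "(\<lambda>h. W' (U' h)) =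
        (\<lambda>h. t *\<^sub>R V' (U' h) + fst h *\<^sub>R V a - snd h *\<^sub>R mat 1)"
      by (rule has_derivative_unique)
    from fun_cong[OF this, of h] show ?thesis
      by (simp add: B_def)
  qed

  have B_comm: "V a ** B \<xi> = B \<xi> ** V a" for \<xi>
  proof -
    note FD = bounded_bilinear.FDERIV[OF bounded_bilinear_matrix_matrix_mult]
    have "((\<lambda>b. W b ** V b) has_derivative (\<lambda>\<xi>. V a ** W' \<xi> + V' \<xi> ** W a)) (at a)"
      by (rule has_derivative_transform_within_open[OF FD[OF V' W'] D_open a]) (simp add: comm)
    from has_derivative_unique[OF this FD[OF W' V']]
    have "V a ** W' \<xi> + V' \<xi> ** W a = W a ** V' \<xi> + W' \<xi> ** V a"
      by (simp add: fun_eq_iff)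
    then show ?thesis
      by (simp add: B_def Wa matrix_diff_left matrix_diff_right matrix_scaleR_left
          matrix_scaleR_right algebra_simps)
  qed

  \<comment> \<open>When \<open>W = t V - x I\<close> is inserted, the two terms with \<open>x D\<^sub>\<xi> V\<close> cancel and the rest assembles
    to \<open>B\<close>.\<close>
  have B_quad: "(V a ** B \<xi> - B (V a *v \<xi>)) *v \<xi> = 0" for \<xi>
  proof -
    have "V' (W a *v \<xi>) = t *\<^sub>R V' (V a *v \<xi>) - x *\<^sub>R V' \<xi>"
      by (simp add: Wa matrix_vector_mult_diff_rdistrib linear_diff[OF linV] linear_scale[OF linV]
          flip: scaleR_matrix_vector_assoc)
    then have "V' (W a *v \<xi>) - W' (V a *v \<xi>) + V a ** W' \<xi> - W a ** V' \<xi>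
        = V a ** B \<xi> - B (V a *v \<xi>)"
      by (simp add: B_def Wa matrix_diff_left matrix_diff_right matrix_scaleR_left
          matrix_scaleR_right algebra_simps)
    then show ?thesis
      using flows[OF a, of \<xi>] by (simp add: dir_deriv_eq_frechet[OF V'] dir_deriv_eq_frechet[OF W'])
  qed

  have "q + V a *v p = 0"
    by (rule flow_from_commuting_derivatives[OF cyclic_vector_V[OF nz[OF a]] linB B_comm B_quad])
       (simp_all add: p_def q_def B_U')
  then show "vector_derivative (\<lambda>s. U (s, x)) (at t)
      + V (U (t, x)) *v vector_derivative (\<lambda>y. U (t, y)) (at x) = 0"
    by (simp add: q p a_def)
qed

end
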